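(* For all integers $k\ge 1$, $n\ge 0$ and all $$(a,b,c)\in\{(1,2,3),(1,2,5),(1,3,5)\},$$ we have $\gamma_{a,b,c,1,0}^k(n)\ge 0$; that is, the coefficient of $q^n$ in $$\frac{1}{(1-q^a)(1-q^b)(1-q^c)}\sum_{j\notin[-k,k-1]}(-1)^{j+k}q^{j^2}$$ is nonnegative.
   Context: Identities are between formal power series in $q$. The sum $\sum_{j\notin[-k,k-1]}$ is over all integers $j\le -k-1$ and all integers $j\ge k$. In general $\gamma_{a,b,c,A,B}^k(n)$ is defined by $\frac{1}{(1-q^a)(1-q^b)(1-q^c)}\sum_{j\notin[-k,k-1]}(-1)^{j+k}q^{Aj^2+Bj}=\sum_{n\ge0}\gamma_{a,b,c,A,B}^k(n)q^n$. *)

theory Defs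
  imports "HOL-Analysis.Analysis"
begin

text \<open>
  The infinite sum is the library's unordered sum in the topology of the formal power series ring.
  The parameters \<open>A\<close> and \<open>B\<close> are rational so that exponents such as \<open>j (3 j + 1) / 2\<close> are covered.
  The numbers \<open>A j\<^sup>2 + B j\<close> are meant to be nonnegative integers; \<open>nat\<close> and the floor merely
  convert their type.
\<close>

definition tail_exponent :: "rat \<Rightarrow> rat \<Rightarrow> int \<Rightarrow> nat" where
  "tail_exponent A B j = nat \<lfloor>A * of_int j ^ 2 + B * of_int j\<rfloor>"

definition theta_tail :: "rat \<Rightarrow> rat \<Rightarrow> int \<Rightarrow> rat fps" where
  "theta_tail A B k =
     (\<Sum>\<^sub>\<infinity>j\<in>{j. j \<notin> {-k..k - 1}}. fps_const ((-1) powi (j + k)) * fps_X ^ tail_exponent A B j)"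

definition \<gamma> :: "nat \<Rightarrow> nat \<Rightarrow> nat \<Rightarrow> rat \<Rightarrow> rat \<Rightarrow> int \<Rightarrow> nat \<Rightarrow> rat" where
  "\<gamma> a b c A B k n =
     fps_nth (1 / ((1 - fps_X ^ a) * (1 - fps_X ^ b) * (1 - fps_X ^ c)) * theta_tail A B k) n"

lemma finite_tail_exponent_le:
  assumes "A > 0"
  shows "finite {j. tail_exponent A B j \<le> m}"
proof (rule finite_subset)
  define N where "N = \<lceil>(of_nat m + 1 + \<bar>B\<bar>) / A\<rceil> + 1"
  show "{j. tail_exponent A B j \<le> m} \<subseteq> {-N..N}"
  proof (rule subsetI, rule ccontr)
    fix j assume j: "j \<in> {j. tail_exponent A B j \<le> m}" "j \<notin> {-N..N}"
    have "0 \<le> (of_nat m + 1 + \<bar>B\<bar>) / A" using assms by simp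
    hence "N \<ge> 1" unfolding N_def by linarith
    have J: "\<bar>j\<bar> > N" using j(2) by auto
    have N: "of_int N \<ge> (of_nat m + 1 + \<bar>B\<bar>) / A"
      unfolding N_def by linarith
    define x :: rat where "x = of_int \<bar>j\<bar>"
    have x: "x \<ge> 1" "x \<ge> (of_nat m + 1 + \<bar>B\<bar>) / A"
    proof -
      have "x > of_int N" unfolding x_def using J by (simp only: of_int_less_iff)
      moreover have "(1::rat) \<le> of_int N" using \<open>N \<ge> 1\<close> by simp
      ultimately show "x \<ge> 1" "x \<ge> (of_nat m + 1 + \<bar>B\<bar>) / A" using N by linarith+
    qed
    have "of_nat m + 1 \<le> A * x - \<bar>B\<bar>" using x(2) assms by (simp add: field_simps)
    also from this have "A * x - \<bar>B\<bar> \<le> x * (A * x - \<bar>B\<bar>)"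
      using mult_right_mono[OF x(1), of "A * x - \<bar>B\<bar>"] by simp
    also have "x * (A * x - \<bar>B\<bar>) \<le> A * of_int j ^ 2 + B * of_int j"
    proof -
      have "- (\<bar>B\<bar> * x) \<le> B * of_int j"
        using abs_ge_minus_self[of "B * of_int j"] by (simp add: x_def abs_mult)
      moreover have "x * x = of_int j ^ 2"
        by (simp add: x_def power2_eq_square)
      hence "A * (x * x) = A * of_int j ^ 2" by (rule arg_cong)
      moreover have "x * (A * x - \<bar>B\<bar>) = A * (x * x) - \<bar>B\<bar> * x"
        by (simp add: algebra_simps)
      ultimately show ?thesis by linarith
    qed
    finally have "of_nat m + 1 \<le> A * of_int j ^ 2 + B * of_int j" .
    hence "int m + 1 \<le> \<lfloor>A * of_int j ^ 2 + B * of_int j\<rfloor>" by (simp add: le_floor_iff)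
    thus False using j(1) by (simp add: tail_exponent_def)
  qed
qed simp

lemma theta_tail_has_sum:
  assumes "A > 0"
  shows "((\<lambda>j. fps_const ((-1) powi (j + k)) * fps_X ^ tail_exponent A B j)
            has_sum theta_tail A B k) {j. j \<notin> {-k..k - 1}}"
    and "fps_nth (theta_tail A B k) m =
           (\<Sum>j | j \<notin> {-k..k - 1} \<and> tail_exponent A B j = m. (-1) powi (j + k))"
proof -
  let ?S = "{j. j \<notin> {-k..k - 1}}"
  define F :: "int \<Rightarrow> rat fps" where
    "F = (\<lambda>j. fps_const ((-1) powi (j + k)) * fps_X ^ tail_exponent A B j)"
  have nth: "fps_nth (F j) m = (if tail_exponent A B j = m then (-1) powi (j + k) else 0)" for j m
    by (auto simp: F_def)
  have supp: "{j \<in> ?S. fps_nth (F j) m \<noteq> 0} = {j. j \<notin> {-k..k - 1} \<and> tail_exponent A B j = m}" for m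
    by (auto simp: nth)
  have fin: "finite {j \<in> ?S. fps_nth (F j) m \<noteq> 0}" for m
    unfolding supp by (rule finite_subset[OF _ finite_tail_exponent_le[OF assms, of B m]]) auto
  have "(F has_sum Abs_fps (\<lambda>m. \<Sum>j | j \<in> ?S \<and> fps_nth (F j) m \<noteq> 0. fps_nth (F j) m)) ?S"
    by (rule has_sum_fpsI[OF fin]) simp
  hence "F summable_on ?S" by (rule has_sum_imp_summable)
  hence sum: "(F has_sum theta_tail A B k) ?S"
    unfolding theta_tail_def F_def[symmetric] by (rule has_sum_infsum)
  thus "((\<lambda>j. fps_const ((-1) powi (j + k)) * fps_X ^ tail_exponent A B j)
            has_sum theta_tail A B k) ?S"
    by (simp only: F_def)
  show "fps_nth (theta_tail A B k) m =
          (\<Sum>j | j \<notin> {-k..k - 1} \<and> tail_exponent A B j = m. (-1) powi (j + k))"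
    unfolding has_sum_fpsD(2)[OF sum] supp by (rule sum.cong) (auto simp: nth)
qed

end

theory Submission
  imports Defs
begin

text \<open>
  The coefficients \<open>p n\<close> of \<open>1 / ((1 - q\<^sup>a) (1 - q\<^sup>b) (1 - q\<^sup>c))\<close> are quadratic up to rounding:
  \<open>p n = 1 + \<lfloor>n (n + s) / N\<rfloor>\<close> with \<open>s = a + b + c\<close> and \<open>N = 2 a b c\<close>.
  Consecutive tails satisfy \<open>G\<^sub>k + G\<^sub>k\<^sub>+\<^sub>1 = p (n - k\<^sup>2) - p (n - (k + 1)\<^sup>2)\<close>. If rounding is ignored,
  this recurrence is solved in closed form: with \<open>M = \<lfloor>\<surd>n\<rfloor>\<close>, \<open>N G\<^sub>k\<close> is
  \<open>k (2 n + s - 2 k\<^sup>2 + 1)\<close> up to a term \<open>\<plusminus> H\<close> independent of \<open>k\<close> that is at most about \<open>n\<close>.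
  The main term is at least about \<open>2 n\<close> for \<open>1 \<le> k < M\<close>, and the rounding errors add up to
  \<open>O (M)\<close> only. So the tails are nonnegative for \<open>M \<ge> 23\<close> (or less, depending on \<open>a, b, c\<close>), and
  the finitely many remaining \<open>n\<close> are checked by running the recurrence downwards from \<open>k = M\<close>.
\<close>

section \<open>Quasi-polynomial coefficients and their rounding error\<close>

definition quasi :: "int \<Rightarrow> int \<Rightarrow> int \<Rightarrow> int" where
  "quasi N s z = 1 + z * (z + s) div N"

lemma quasi_add_mult:
  assumes "N > 0"
  shows "quasi N s (N * q + r) = q * (N * q + 2 * r + s) + quasi N s r"
proof -
  have "(N * q + r) * (N * q + r + s) = r * (r + s) + N * (q * (N * q + 2 * r + s))"
    by (simp add: algebra_simps)
  thus ?thesis using assms by (simp add: quasi_def)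
qed

text \<open>With \<open>z = N * q + r\<close>, a shift by \<open>d\<close> changes the difference
  between \<open>quasi\<close> at \<open>z - d\<close> and at \<open>r - d\<close> only by a term
  affine in \<open>d\<close>. The third difference kills such terms, so it is periodic in
  \<open>z\<close> and one period suffices.\<close>

lemma third_difference_quasi:
  assumes "N > 0"
    and "\<And>r. r \<in> {0..<N} \<Longrightarrow>
      quasi N s r - quasi N s (r - a) - quasi N s (r - b) - quasi N s (r - c)
      + quasi N s (r - a - b) + quasi N s (r - a - c) + quasi N s (r - b - c)
      - quasi N s (r - a - b - c) = 0"
  shows "quasi N s z - quasi N s (z - a) - quasi N s (z - b) - quasi N s (z - c)
      + quasi N s (z - a - b) + quasi N s (z - a - c) + quasi N s (z - b - c)
      - quasi N s (z - a - b - c) = 0"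
proof -
  define q r where "q = z div N" and "r = z mod N"
  have "r \<in> {0..<N}" using assms(1) by (simp add: r_def)
  note r = assms(2)[OF this]
  have shift: "quasi N s (z - d) = q * (N * q + 2 * (r - d) + s) + quasi N s (r - d)" for d
    using quasi_add_mult[OF assms(1), of s q "r - d"] by (simp add: q_def r_def algebra_simps)
  show ?thesis
    using r shift[of 0] shift[of a] shift[of b] shift[of c] shift[of "a + b"] shift[of "a + c"]
      shift[of "b + c"] shift[of "a + b + c"]
    by (simp add: algebra_simps)
qed

lemma quasi_residue_bound:
  assumes "N > 0" and "\<And>r. r \<in> {0..<N} \<Longrightarrow> r * (r + s) mod N \<le> w"
  shows "N * quasi N s z \<in> {z * (z + s) + N - w..z * (z + s) + N}"
proof -
  have "z * (z + s) mod N = (z mod N) * (z mod N + s) mod N"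
    by (rule mod_mult_cong) (simp_all add: mod_simps)
  also have "\<dots> \<le> w" using assms by simp
  finally have "z * (z + s) mod N \<le> w" .
  moreover have "0 \<le> z * (z + s) mod N" using assms(1) by simp
  moreover have "N * (z * (z + s) div N) = z * (z + s) - z * (z + s) mod N"
    by (simp add: minus_mod_eq_mult_div)
  ultimately show ?thesis by (simp add: quasi_def distrib_left)
qed

section \<open>Finite verification by descending recurrence\<close>

text \<open>The coefficient of \<open>q^n\<close> in \<open>q^(m*m)\<close> over the triple product.
  The cutoff is essential: for \<open>N > 0\<close> and \<open>s >= 0\<close>, \<open>quasi\<close>
  is positive again at arguments \<open>-s\<close> and below.\<close>

definition square_term :: "int \<Rightarrow> int \<Rightarrow> int \<Rightarrow> int \<Rightarrow> int" where
  "square_term N s n m = (if m * m \<le> n then quasi N s (n - m * m) else 0)"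

text \<open>
  For the head \<open>k\<close> of the list, \<open>acc\<close> is the tail \<open>G\<^sub>k\<^sub>+\<^sub>1\<close> and \<open>prev\<close> is the square term at \<open>k + 1\<close>.
  The auxiliary function makes the simplifier evaluate \<open>cur\<close> only once.
\<close>
fun tails_nonneg and tails_nonneg_step where
  "tails_nonneg N s n [] prev acc \<longleftrightarrow> 0 \<le> acc"
| "tails_nonneg N s n (k # ks) prev acc \<longleftrightarrow>
     0 \<le> acc \<and> tails_nonneg_step N s n ks prev acc (square_term N s n k)"
| "tails_nonneg_step N s n ks prev acc cur \<longleftrightarrow> tails_nonneg N s n ks cur (cur - prev - acc)"

text \<open>The listed \<open>n\<close> are exactly those whose square root has floor
  \<open>M\<close>; for them the square term and the tail at \<open>M + 1\<close> vanish, hence the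
  initial zeros.\<close>

definition block_tails_nonneg :: "int \<Rightarrow> int \<Rightarrow> int \<Rightarrow> bool" where
  "block_tails_nonneg N s M \<longleftrightarrow>
     list_all (\<lambda>n. tails_nonneg N s n (rev [1..M]) 0 0) [M * M..M * M + 2 * M]"

text \<open>One unfolding of the check moves its state from \<open>M + 1\<close> to
  \<open>M\<close>. The induction runs along the list, so \<open>M\<close> is a position in it and
  the accumulators are arbitrary.\<close>

lemma tails_nonneg_sound:
  fixes G :: "int \<Rightarrow> int"
  assumes rec: "\<And>k. k \<ge> 0 \<Longrightarrow> G k + G (k + 1) = square_term N s n k - square_term N s n (k + 1)"
    and "tails_nonneg N s n (rev [1..M]) (square_term N s n (M + 1)) (G (M + 1))"
    and "1 \<le> k" "k \<le> M + 1"
  shows "G k \<ge> 0"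
  using assms(2-)
proof (induction "nat M" arbitrary: M k)
  case 0
  hence "M = 0" "k = 1" by auto
  with 0 show ?case by simp
next
  case (Suc d)
  hence M: "M \<ge> 1" by simp
  have "[1..M] = [1..M - 1] @ [M]" using M by (simp add: upto_rec2)
  hence "tails_nonneg N s n (rev [1..M - 1]) (square_term N s n M)
      (square_term N s n M - square_term N s n (M + 1) - G (M + 1))" and *: "G (M + 1) \<ge> 0"
    using Suc.prems(1) by auto
  moreover have "square_term N s n M - square_term N s n (M + 1) - G (M + 1) = G M"
    using rec[of M] M by simp
  ultimately have "k \<le> M \<Longrightarrow> G k \<ge> 0"
    using Suc.hyps(1)[of "M - 1" k] Suc.hyps(2) Suc.prems by simp
  with * show ?case using Suc.prems by (cases "k = M + 1") auto
qed

section \<open>Estimate of the tails for large \<open>n\<close>\<close>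

text \<open>The polynomial in \<open>k\<close> solves the unrounded recurrence exactly, and the
  alternating term is the homogeneous solution fitted at \<open>k = M\<close>. The
  \<open>- w\<close> in \<open>K\<close> centres the rounding interval there, giving initial error
  \<open>w\<close>; each further step adds at most \<open>2 * w\<close>.\<close>

lemma alternating_tail_estimate:
  fixes G :: "int \<Rightarrow> int" and j :: nat
  assumes rec: "\<And>k. k \<ge> 0 \<Longrightarrow> G k + G (k + 1) = square_term N s n k - square_term N s n (k + 1)"
    and zero: "G (M + 1) = 0"
    and bound: "\<And>z. N * quasi N s z \<in> {z * (z + s) + N - w..z * (z + s) + N}"
    and M: "M * M \<le> n" "n < (M + 1) * (M + 1)" "0 \<le> M"
  defines "d \<equiv> n - M * (M + 1)"
  defines "K \<equiv> 2 * (d * (d + s) - M * (M + 1)) + 2 * N - w"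
  assumes "int j \<le> M" and "k = M - int j"
  shows "\<bar>2 * N * G k - 2 * k * (2 * n + s - 2 * k * k + 1) - (-1) ^ j * K\<bar>
    \<le> w * (2 * int j + 1)"
  using assms(9-)
proof (induction j arbitrary: k)
  case 0
  have "G M = quasi N s (n - M * M)"
    using rec[of M] zero M by (simp add: square_term_def)
  hence "N * G M \<in> {(n - M * M) * (n - M * M + s) + N - w..(n - M * M) * (n - M * M + s) + N}"
    using bound[of "n - M * M"] by simp
  then show ?case using 0
    by (auto simp: K_def d_def algebra_simps abs_le_iff)
next
  case (Suc j)
  have k: "k + 1 = M - int j" "k \<ge> 0" using Suc.prems by auto
  note IH = Suc.IH[OF _ k(1)]
  \<comment> \<open>Both squares are at most \<open>n\<close>, so the cutoff in
    \<open>square_term\<close> is inactive.\<close>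
  have kk: "k * k \<le> n" "(k + 1) * (k + 1) \<le> n"
    using M k mult_mono[of k M k M] mult_mono[of "k + 1" M "k + 1" M] by auto
  define u where "u = N * quasi N s (n - k * k) - ((n - k * k) * (n - k * k + s) + N)"
  define v where "v = N * quasi N s (n - (k + 1) * (k + 1))
     - ((n - (k + 1) * (k + 1)) * (n - (k + 1) * (k + 1) + s) + N)"
  have uv: "u \<in> {-w..0}" "v \<in> {-w..0}"
    using bound[of "n - k * k"] bound[of "n - (k + 1) * (k + 1)"] by (auto simp: u_def v_def)
  have "G k = quasi N s (n - k * k) - quasi N s (n - (k + 1) * (k + 1)) - G (k + 1)"
    using rec[OF k(2)] kk by (simp add: square_term_def)
  hence "2 * N * G k = 2 * (N * quasi N s (n - k * k))
     - 2 * (N * quasi N s (n - (k + 1) * (k + 1))) - 2 * N * G (k + 1)"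
    by (simp add: right_diff_distrib)
  hence eq: "2 * N * G k - 2 * k * (2 * n + s - 2 * k * k + 1) - (-1) ^ Suc j * K
    = 2 * u - 2 * v - (2 * N * G (k + 1) - 2 * (k + 1) * (2 * n + s - 2 * (k + 1) * (k + 1) + 1)
        - (-1) ^ j * K)"
    by (simp add: u_def v_def algebra_simps)
  have step: "\<bar>x\<bar> \<le> y + 2 * w" if "x = 2 * u - 2 * v - x'" "\<bar>x'\<bar> \<le> y" for x x' y :: int
    using that uv by (auto simp: abs_le_iff)
  have "w * (2 * int (Suc j) + 1) = w * (2 * int j + 1) + 2 * w"
    by (simp add: algebra_simps)
  thus ?case using step[OF eq IH] Suc.prems(1) by (simp only:)
qed

text \<open>\<open>B\<close> bounds the alternating term: completing the square gives the lower
  side, the first inequality in \<open>large\<close> the upper one. The second says that the main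
  term beats \<open>B\<close> plus all rounding errors.\<close>

lemma alternating_tail_nonneg:
  fixes G :: "int \<Rightarrow> int"
  assumes rec: "\<And>k. k \<ge> 0 \<Longrightarrow> G k + G (k + 1) = square_term N s n k - square_term N s n (k + 1)"
    and zero: "G (M + 1) = 0"
    and bound: "\<And>z. N * quasi N s z \<in> {z * (z + s) + N - w..z * (z + s) + N}"
    and M: "M * M \<le> n" "n < (M + 1) * (M + 1)"
    and k: "1 \<le> k" "k < M"
    and N: "0 < N" and w: "0 \<le> w" and s: "0 \<le> s" "s \<le> M" "s * s \<le> 2 * S"
    and large: "2 * (2 * N - w) \<le> 4 * M + S"
      "2 * M * M + 2 * M + S - (2 * N - w) \<le> 4 * (M * M - 1) + 2 * (s + 1) - w * (2 * M - 1)"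
  shows "G k \<ge> 0"
proof -
  define d where "d = n - M * (M + 1)"
  define H where "H = d * (d + s) - M * (M + 1)"
  define K where "K = 2 * H + 2 * N - w"
  define B where "B = 2 * M * M + 2 * M + S - (2 * N - w)"
  define j where "j = nat (M - k)"
  have j: "int j = M - k" using k by (simp add: j_def)
  have d: "-M \<le> d" "d \<le> M" using M by (auto simp: d_def algebra_simps)
  \<comment> \<open>Completing the square gives \<open>2 * d * (d + s) >= - s * s / 2\<close>;
    \<open>S\<close> is an integer bound for \<open>s * s / 2\<close>.\<close>
  have "4 * (d * (d + s)) + s * s = (2 * d + s) * (2 * d + s)" by (simp add: algebra_simps)
  also have "\<dots> \<ge> 0" by simp
  finally have "2 * H \<ge> - (2 * M * M + 2 * M + S)"
    using s by (simp add: H_def algebra_simps)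
  hence "- B \<le> K" by (simp add: K_def B_def)
  moreover have "K \<le> B"
  proof -
    have "\<bar>d\<bar> * \<bar>d + s\<bar> \<le> M * (M + s)" using d s k by (intro mult_mono) auto
    hence "d * (d + s) \<le> M * (M + s)" by (simp flip: abs_mult)
    moreover have "M * s \<le> M * M" using s k by (intro mult_left_mono) auto
    ultimately have "2 * H \<le> 2 * M * M - 2 * M" by (simp add: H_def algebra_simps)
    thus ?thesis using large(1) by (simp add: K_def B_def)
  qed
  ultimately have KB: "\<bar>(-1) ^ j * K\<bar> \<le> B" by (simp add: abs_mult)
  \<comment> \<open>By concavity \<open>k * (M - k)\<close> is smallest at the ends
    \<open>k = 1\<close> and \<open>k = M - 1\<close>. The bound fails at \<open>k = M\<close>,
    which is treated separately.\<close>
  have "(k - 1) * (M - k - 1) \<ge> 0" using k by simp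
  hence "k * (M - k) \<ge> M - 1" by (simp add: algebra_simps)
  hence "(k * (M - k)) * (M + k) \<ge> (M - 1) * (M + 1)" using k by (intro mult_mono) auto
  moreover have "k * n \<ge> k * (M * M)" using M k by simp
  moreover have "k * (s + 1) \<ge> 1 * (s + 1)" using k s by (intro mult_right_mono) auto
  ultimately have "2 * k * (2 * n + s - 2 * k * k + 1) \<ge> 4 * (M * M - 1) + 2 * (s + 1)"
    by (simp add: algebra_simps)
  moreover have "w * (2 * int j + 1) \<le> w * (2 * M - 1)" using w k j by (intro mult_left_mono) auto
  ultimately have "2 * k * (2 * n + s - 2 * k * k + 1) \<ge> B + w * (2 * int j + 1)"
    using large(2) by (simp add: B_def)
  moreover have "\<bar>2 * N * G k - 2 * k * (2 * n + s - 2 * k * k + 1) - (-1) ^ j * K\<bar>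
    \<le> w * (2 * int j + 1)"
    unfolding K_def H_def d_def
    by (rule alternating_tail_estimate[OF rec zero bound M]) (use j k in auto)
  ultimately have "2 * N * G k \<ge> 0" using KB by linarith
  thus ?thesis using N by (simp add: zero_le_mult_iff)
qed

section \<open>Generating function of the coefficients\<close>

text \<open>Multiplication by \<open>1 - X^d\<close> is a backward difference as long as the
  function vanishes on \<open>-d..-1\<close>. The zeros of \<open>h\<close> just below 0 allow this
  for \<open>c\<close> and then \<open>b\<close>.\<close>

lemma inverse_binomial_product:
  fixes a b c :: nat and h :: "int \<Rightarrow> int"
  assumes abc: "a = 1" "b > 0" "c > 0"
    and zero: "\<And>z. - int (a + b + c) < z \<Longrightarrow> z < 0 \<Longrightarrow> h z = 0" and "h 0 = 1"
    and diff: "\<And>z. h z - h (z - int a) - h (z - int b) - h (z - int c)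
      + h (z - int a - int b) + h (z - int a - int c) + h (z - int b - int c)
      - h (z - int a - int b - int c) = 0"
  shows "1 / ((1 - fps_X ^ a) * (1 - fps_X ^ b) * (1 - fps_X ^ c)) =
    Abs_fps (\<lambda>n. of_int (h (int n)) :: 'a :: field)"
proof -
  define E :: "(int \<Rightarrow> int) \<Rightarrow> 'a fps" where "E = (\<lambda>g. Abs_fps (\<lambda>n. of_int (g (int n))))"
  have mult: "E g * (1 - fps_X ^ d) = E (\<lambda>z. g z - g (z - int d))"
    if "\<And>z. - int d \<le> z \<Longrightarrow> z < 0 \<Longrightarrow> g z = 0" for g d
    using that by (auto simp: fps_eq_iff E_def right_diff_distrib fps_X_power_mult_right_nth of_nat_diff)
  have "E h * (1 - fps_X ^ c) * (1 - fps_X ^ b) =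
      E (\<lambda>z. h z - h (z - int c) - (h (z - int b) - h (z - int b - int c)))"
  proof -
    have "E h * (1 - fps_X ^ c) = E (\<lambda>z. h z - h (z - int c))"
      using abc by (intro mult zero) auto
    moreover have "E (\<lambda>z. h z - h (z - int c)) * (1 - fps_X ^ b) =
      E (\<lambda>z. h z - h (z - int c) - (h (z - int b) - h (z - int b - int c)))"
      using abc by (subst mult) (auto simp: zero)
    ultimately show ?thesis by simp
  qed
  \<comment> \<open>The rule \<open>mult\<close> does not apply here, since
    \<open>g (-1) = g 0 = 1\<close>. As \<open>a = 1\<close>, the function \<open>g\<close> is
    constant on the naturals and the product telescopes.\<close>
  also have "\<dots> * (1 - fps_X ^ a) = 1"
  proof (rule fps_ext)
    fix n
    define g where "g = (\<lambda>z. h z - h (z - int c) - (h (z - int b) - h (z - int b - int c)))"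
    have "g (int n) = g (int n - 1)"
      using diff[of "int n"] abc by (simp add: g_def algebra_simps)
    moreover have "g 0 = 1"
      using abc zero[of "- int b"] zero[of "- int c"] zero[of "- int b - int c"] \<open>h 0 = 1\<close>
      by (simp add: g_def)
    ultimately have "fps_nth (E g * (1 - fps_X ^ a)) n = fps_nth 1 n"
      using abc by (cases n) (auto simp: E_def algebra_simps)
    thus "fps_nth (E (\<lambda>z. h z - h (z - int c) - (h (z - int b) - h (z - int b - int c)))
        * (1 - fps_X ^ a)) n = fps_nth 1 n"
      by (simp only: g_def)
  qed
  finally have "E h * ((1 - fps_X ^ a) * (1 - fps_X ^ b) * (1 - fps_X ^ c)) = 1"
    by (simp add: mult_ac)
  moreover from this have "(1 - fps_X ^ a) * (1 - fps_X ^ b) * (1 - fps_X ^ c) \<noteq> (0 :: 'a fps)"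
    by (metis mult_zero_right zero_neq_one)
  ultimately show ?thesis
    by (metis E_def nonzero_mult_div_cancel_right)
qed

section \<open>Tails of the theta series\<close>

lemma tail_exponent_square: "tail_exponent 1 0 j = nat (j * j)"
  by (simp add: tail_exponent_def power2_eq_square flip: of_int_mult)

lemma fps_nth_theta_tail_square:
  "fps_nth (theta_tail 1 0 k) m =
     (\<Sum>j | j \<notin> {-k..k - 1} \<and> j * j = int m. (-1) powi (j + k))"
  unfolding theta_tail_has_sum(2)[of 1 0 k m, simplified]
  by (rule sum.cong) (auto simp: tail_exponent_square)

lemma finite_square_roots: "finite {j :: int. P j \<and> j * j = int m}"
  by (rule finite_subset[OF _ finite_tail_exponent_le[of 1 0 m]]) (auto simp: tail_exponent_square)

text \<open>Common summands change sign from \<open>k\<close> to \<open>k + 1\<close> and cancel.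
  Only the indices \<open>k\<close> and \<open>-k - 1\<close> survive, with signs 1 and -1.\<close>

lemma theta_tail_square_rec:
  assumes "k \<ge> 0"
  shows "theta_tail 1 0 k + theta_tail 1 0 (k + 1) =
    fps_X ^ nat (k * k) - fps_X ^ nat ((k + 1) * (k + 1))"
proof (rule fps_ext)
  fix m
  let ?S = "\<lambda>k. {j :: int. j \<notin> {-k..k - 1} \<and> j * j = int m}"
  let ?A = "{j. j = k \<and> j * j = int m}" and ?B = "{j. j = -k - 1 \<and> j * j = int m}"
  have split: "?S k = ?S (k + 1) \<union> (?A \<union> ?B)" using assms by auto
  have "fps_nth (theta_tail 1 0 k) m = (\<Sum>j\<in>?S (k + 1). (-1) powi (j + k))
      + ((\<Sum>j\<in>?A. (-1) powi (j + k)) + (\<Sum>j\<in>?B. (-1) powi (j + k)))"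
  proof -
    have fin: "finite (?S (k + 1))" "finite ?A" "finite ?B" by (rule finite_square_roots)+
    have "?S (k + 1) \<inter> (?A \<union> ?B) = {}" "?A \<inter> ?B = {}" using assms by (auto, presburger)
    thus ?thesis unfolding fps_nth_theta_tail_square split
      by (simp only: sum.union_disjoint fin finite_UnI)
  qed
  also have "(\<Sum>j\<in>?S (k + 1). (-1) powi (j + k)) = - fps_nth (theta_tail 1 0 (k + 1)) m"
    unfolding fps_nth_theta_tail_square sum_negf[symmetric]
    by (rule sum.cong) (simp_all add: power_int_add)
  also have "?A = (if k * k = int m then {k} else {})" by auto
  also have "?B = (if (-k - 1) * (-k - 1) = int m then {-k - 1} else {})" by auto
  also have "(-k - 1) * (-k - 1) = (k + 1) * (k + 1)" by (simp add: algebra_simps)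
  finally have *: "fps_nth (theta_tail 1 0 k) m = - fps_nth (theta_tail 1 0 (k + 1)) m +
     ((\<Sum>j\<in>(if k * k = int m then {k} else {}). (-1) powi (j + k)) +
      (\<Sum>j\<in>(if (k + 1) * (k + 1) = int m then {-k - 1} else {}). (-1) powi (j + k)))" .
  have "(-1 :: rat) powi (k + k) = 1" by (simp add: power_int_add)
  moreover have "(-1 :: rat) powi (-k - 1 + k) = -1" by simp
  ultimately show "fps_nth (theta_tail 1 0 k + theta_tail 1 0 (k + 1)) m =
      fps_nth (fps_X ^ nat (k * k) - fps_X ^ nat ((k + 1) * (k + 1))) m"
    using assms by (auto simp: * nat_eq_iff)
qed

lemma theta_tail_square_low:
  assumes "k \<ge> 0" "int m < k * k"
  shows "fps_nth (theta_tail 1 0 k) m = 0"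
proof -
  have "j * j \<noteq> int m" if "j \<notin> {-k..k - 1}" for j
  proof -
    have "k * k \<le> \<bar>j\<bar> * \<bar>j\<bar>" using that assms by (intro mult_mono) auto
    thus ?thesis using assms by (simp flip: abs_mult)
  qed
  hence "{j. j \<notin> {-k..k - 1} \<and> j * j = int m} = {}" by auto
  thus ?thesis by (simp only: fps_nth_theta_tail_square sum.empty)
qed

section \<open>Combining finite check and estimate\<close>

lemma \<gamma>_square_nonneg:
  fixes k :: int and a b c n :: nat
  assumes inv: "1 / ((1 - fps_X ^ a) * (1 - fps_X ^ b) * (1 - fps_X ^ c)) =
      Abs_fps (\<lambda>i. of_int (quasi N s (int i)) :: rat)"
    and pos: "\<And>z. z \<ge> 0 \<Longrightarrow> quasi N s z \<ge> 0"
    and bound: "\<And>z. N * quasi N s z \<in> {z * (z + s) + N - w..z * (z + s) + N}"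
    and N: "0 < N" and w: "0 \<le> w" and s: "0 \<le> s" "s * s \<le> 2 * S"
    and small: "\<forall>M\<in>{0..L - 1}. block_tails_nonneg N s M"
    and large: "\<And>M. M \<ge> L \<Longrightarrow> s \<le> M \<and> 2 * (2 * N - w) \<le> 4 * M + S \<and>
      2 * M * M + 2 * M + S - (2 * N - w) \<le> 4 * (M * M - 1) + 2 * (s + 1) - w * (2 * M - 1)"
    and "k \<ge> 1"
  shows "\<gamma> a b c 1 0 k n \<ge> 0"
proof -
  define P :: "rat fps" where "P = Abs_fps (\<lambda>i. of_int (quasi N s (int i)))"
  \<comment> \<open>The coefficients are integers, so the floor only changes the type.\<close>
  define G where "G k = \<lfloor>\<gamma> a b c 1 0 k n\<rfloor>" for k
  have \<gamma>: "\<gamma> a b c 1 0 k n = fps_nth (P * theta_tail 1 0 k) n" for k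
    by (simp add: \<gamma>_def inv P_def)
  have "\<gamma> a b c 1 0 k n \<in> \<int>" for k
    unfolding \<gamma> fps_mult_nth fps_nth_theta_tail_square
    by (intro Ints_sum Ints_mult) (auto simp: P_def power_int_def)
  hence G: "of_int (G k) = \<gamma> a b c 1 0 k n" for k
    by (simp add: G_def)
  have low: "G k = 0" if "k \<ge> 0" "int n < k * k" for k
  proof -
    have "fps_nth (theta_tail 1 0 k) (n - i) = 0" for i
      using that by (intro theta_tail_square_low) auto
    hence "\<gamma> a b c 1 0 k n = 0" unfolding \<gamma> fps_mult_nth by simp
    thus ?thesis by (simp add: G_def)
  qed
  have X: "fps_nth (P * fps_X ^ nat (k * k)) n = of_int (square_term N s (int n) k)" for k
    by (auto simp: fps_X_power_mult_right_nth P_def square_term_def of_nat_diff nat_le_iff nat_less_iff)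
  have rec: "G k + G (k + 1) = square_term N s (int n) k - square_term N s (int n) (k + 1)"
    if "k \<ge> 0" for k
  proof -
    have "\<gamma> a b c 1 0 k n + \<gamma> a b c 1 0 (k + 1) n =
        fps_nth (P * (theta_tail 1 0 k + theta_tail 1 0 (k + 1))) n"
      by (simp add: \<gamma> distrib_left)
    also have "\<dots> = of_int (square_term N s (int n) k - square_term N s (int n) (k + 1))"
      unfolding theta_tail_square_rec[OF that] right_diff_distrib fps_sub_nth X by simp
    finally have "(of_int (G k + G (k + 1)) :: rat) =
        of_int (square_term N s (int n) k - square_term N s (int n) (k + 1))"
      by (simp add: G)
    thus ?thesis by (simp only: of_int_eq_iff)
  qed
  define M where "M = \<lfloor>sqrt (real n)\<rfloor>"
  have M: "0 \<le> M" by (simp add: M_def)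
  have "real_of_int M \<le> sqrt (real n)" "sqrt (real n) < real_of_int (M + 1)"
    unfolding M_def by linarith+
  hence "real_of_int M ^ 2 \<le> sqrt (real n) ^ 2" "sqrt (real n) ^ 2 < real_of_int (M + 1) ^ 2"
    using M by (auto intro!: power_mono power_strict_mono simp del: real_sqrt_pow2)
  hence "of_int (M * M) \<le> (of_int (int n) :: real)" "(of_int (int n) :: real) < of_int ((M + 1) * (M + 1))"
    by (simp_all add: power2_eq_square)
  hence n: "M * M \<le> int n" "int n < (M + 1) * (M + 1)"
    by (simp_all only: of_int_le_iff of_int_less_iff)
  have zero: "G (M + 1) = 0" using low[of "M + 1"] M n by simp
  \<comment> \<open>In turn: the tail starts beyond \<open>q^n\<close>; the finite check applies; a
    single square term is left; the estimate applies.\<close>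
  consider "k > M" | "k \<le> M" "M < L" | "k = M" "M \<ge> L" | "k < M" "M \<ge> L" by linarith
  hence "G k \<ge> 0"
  proof cases
    case 1
    hence "(M + 1) * (M + 1) \<le> k * k" using M by (intro mult_mono) auto
    thus ?thesis using low[of k] n \<open>k \<ge> 1\<close> by simp
  next
    case 2
    have "tails_nonneg N s (int n) (rev [1..M]) 0 0"
      using small 2 M n by (auto simp: block_tails_nonneg_def list_all_iff algebra_simps)
    moreover have "square_term N s (int n) (M + 1) = 0"
      using n by (simp add: square_term_def)
    ultimately show ?thesis
      using tails_nonneg_sound[OF rec, of M k] zero 2 \<open>k \<ge> 1\<close> by simp
  next
    case 3
    have "G M = square_term N s (int n) M" using rec[OF M] zero n
      by (simp add: square_term_def)
    thus ?thesis using 3 n pos by (simp add: square_term_def)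
  next
    case 4
    thus ?thesis using large[of M] \<open>k \<ge> 1\<close>
      by (intro alternating_tail_nonneg[OF rec zero bound n _ _ N w s(1) _ s(2)]) auto
  qed
  thus ?thesis by (simp flip: G)
qed

lemma quasi_nonneg:
  assumes "N > 0" "s \<ge> 0" "z \<ge> 0"
  shows "quasi N s z \<ge> 0"
  using assms by (simp add: quasi_def pos_imp_zdiv_nonneg_iff)

text \<open>Periodicity reduces the facts on \<open>quasi\<close> to finite ranges. \<open>x\<close>
  and \<open>y\<close> are integer copies of \<open>b\<close> and \<open>c\<close>, so that
  instances are plain integer arithmetic.\<close>

lemma \<gamma>_square_nonneg_by_check:
  fixes k x y :: int and b c n :: nat
  assumes xy: "int b = x" "int c = y" "b > 0" "c > 0" and s: "s = 1 + x + y"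
    and vanish: "\<forall>z\<in>{1 - s..-1}. quasi N s z = 0"
    and residue: "\<forall>r\<in>{0..N - 1}. r * (r + s) mod N \<le> w"
    and diff: "\<forall>r\<in>{0..N - 1}.
      quasi N s r - quasi N s (r - 1) - quasi N s (r - x) - quasi N s (r - y)
      + quasi N s (r - 1 - x) + quasi N s (r - 1 - y) + quasi N s (r - x - y)
      - quasi N s (r - 1 - x - y) = 0"
    and N: "0 < N" and w: "0 \<le> w" and S: "s * s \<le> 2 * S"
    and small: "\<forall>M\<in>{0..L - 1}. block_tails_nonneg N s M"
    and large: "\<And>M. M \<ge> L \<Longrightarrow> s \<le> M \<and> 2 * (2 * N - w) \<le> 4 * M + S \<and>
      2 * M * M + 2 * M + S - (2 * N - w) \<le> 4 * (M * M - 1) + 2 * (s + 1) - w * (2 * M - 1)"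
    and k: "k \<ge> 1"
  shows "\<gamma> 1 b c 1 0 k n \<ge> 0"
proof (rule \<gamma>_square_nonneg[OF _ _ _ N w _ S small large k])
  show "1 / ((1 - fps_X ^ 1) * (1 - fps_X ^ b) * (1 - fps_X ^ c)) =
      Abs_fps (\<lambda>i. of_int (quasi N s (int i)) :: rat)"
  proof (rule inverse_binomial_product)
    show "quasi N s 0 = 1" by (simp add: quasi_def)
    show "quasi N s z = 0" if "- int (1 + b + c) < z" "z < 0" for z
      using xy s vanish that by auto
    show "quasi N s z - quasi N s (z - int 1) - quasi N s (z - int b) - quasi N s (z - int c)
      + quasi N s (z - int 1 - int b) + quasi N s (z - int 1 - int c)
      + quasi N s (z - int b - int c) - quasi N s (z - int 1 - int b - int c) = 0" for z
      by (rule third_difference_quasi[OF N]) (use diff xy in auto)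
  qed (use xy in auto)
  show "N * quasi N s z \<in> {z * (z + s) + N - w..z * (z + s) + N}" for z
    by (rule quasi_residue_bound[OF N]) (use residue in auto)
  show "0 \<le> s" using xy s by simp
  thus "quasi N s z \<ge> 0" if "z \<ge> 0" for z
    using that N by (intro quasi_nonneg)
qed

section \<open>The three parameter triples\<close>

text \<open>Here and below, \<open>w\<close> is the largest residue of \<open>r * (r + s)\<close>
  modulo \<open>N\<close>, \<open>S\<close> is \<open>s * s / 2\<close> rounded up, and
  \<open>L\<close> is the least threshold from which all inequalities hold.\<close>

lemma \<gamma>_1_2_3_nonneg:
  assumes "list_all (block_tails_nonneg 12 6) [0..6]" and "k \<ge> 1"
  shows "\<gamma> 1 2 3 1 0 k n \<ge> 0"
proof (rule \<gamma>_square_nonneg_by_check[where x = 2 and y = 3 and N = 12 and s = 6 and w = 7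
    and S = 18 and L = 7])
  show "\<forall>z\<in>{1 - 6..-1}. quasi 12 6 z = 0" by (simp add: quasi_def upto_rec1 flip: set_upto)
  show "\<forall>r\<in>{0..12 - 1 :: int}. r * (r + 6) mod 12 \<le> 7" by (simp add: upto_rec1 flip: set_upto)
  show "\<forall>r\<in>{0..12 - 1}.
      quasi 12 6 r - quasi 12 6 (r - 1) - quasi 12 6 (r - 2) - quasi 12 6 (r - 3)
      + quasi 12 6 (r - 1 - 2) + quasi 12 6 (r - 1 - 3)
      + quasi 12 6 (r - 2 - 3) - quasi 12 6 (r - 1 - 2 - 3) = 0"
    by (simp add: upto_rec1 flip: set_upto) (simp add: quasi_def)
  show "\<forall>M\<in>{0..7 - 1}. block_tails_nonneg 12 6 M"
    using assms(1) by (simp add: list_all_iff)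
next
  fix M :: int
  assume "M \<ge> 7"
  \<comment> \<open>The quadratic inequality reduces to \<open>8 * M <= M * M + 8\<close>, which
    this product yields with \<open>M * M\<close> as an atom.\<close>
  moreover from this have "0 \<le> (M - 7) * (M - 1)" by simp
  ultimately show "6 \<le> M \<and> 2 * (2 * 12 - 7) \<le> 4 * M + 18 \<and>
      2 * M * M + 2 * M + 18 - (2 * 12 - 7) \<le> 4 * (M * M - 1) + 2 * (6 + 1) - 7 * (2 * M - 1)"
    by (simp add: algebra_simps)
qed (use assms(2) in simp_all)

lemma \<gamma>_1_2_5_nonneg:
  assumes "list_all (block_tails_nonneg 20 8) [0..13]" and "k \<ge> 1"
  shows "\<gamma> 1 2 5 1 0 k n \<ge> 0"
proof (rule \<gamma>_square_nonneg_by_check[where x = 2 and y = 5 and N = 20 and s = 8 and w = 13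
    and S = 32 and L = 14])
  show "\<forall>z\<in>{1 - 8..-1}. quasi 20 8 z = 0" by (simp add: quasi_def upto_rec1 flip: set_upto)
  show "\<forall>r\<in>{0..20 - 1 :: int}. r * (r + 8) mod 20 \<le> 13" by (simp add: upto_rec1 flip: set_upto)
  show "\<forall>r\<in>{0..20 - 1}.
      quasi 20 8 r - quasi 20 8 (r - 1) - quasi 20 8 (r - 2) - quasi 20 8 (r - 5)
      + quasi 20 8 (r - 1 - 2) + quasi 20 8 (r - 1 - 5)
      + quasi 20 8 (r - 2 - 5) - quasi 20 8 (r - 1 - 2 - 5) = 0"
    by (simp add: upto_rec1 flip: set_upto) (simp add: quasi_def)
  show "\<forall>M\<in>{0..14 - 1}. block_tails_nonneg 20 8 M"
    using assms(1) by (simp add: list_all_iff)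
next
  fix M :: int
  assume "M \<ge> 14"
  moreover from this have "0 \<le> (M - 14) * (M - 1)" by simp
  ultimately show "8 \<le> M \<and> 2 * (2 * 20 - 13) \<le> 4 * M + 32 \<and>
      2 * M * M + 2 * M + 32 - (2 * 20 - 13) \<le> 4 * (M * M - 1) + 2 * (8 + 1) - 13 * (2 * M - 1)"
    by (simp add: algebra_simps)
qed (use assms(2) in simp_all)

lemma \<gamma>_1_3_5_nonneg:
  assumes "list_all (block_tails_nonneg 30 9) [0..22]" and "k \<ge> 1"
  shows "\<gamma> 1 3 5 1 0 k n \<ge> 0"
proof (rule \<gamma>_square_nonneg_by_check[where x = 3 and y = 5 and N = 30 and s = 9 and w = 22
    and S = 41 and L = 23])
  show "\<forall>z\<in>{1 - 9..-1}. quasi 30 9 z = 0" by (simp add: quasi_def upto_rec1 flip: set_upto)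
  show "\<forall>r\<in>{0..30 - 1 :: int}. r * (r + 9) mod 30 \<le> 22" by (simp add: upto_rec1 flip: set_upto)
  show "\<forall>r\<in>{0..30 - 1}.
      quasi 30 9 r - quasi 30 9 (r - 1) - quasi 30 9 (r - 3) - quasi 30 9 (r - 5)
      + quasi 30 9 (r - 1 - 3) + quasi 30 9 (r - 1 - 5)
      + quasi 30 9 (r - 3 - 5) - quasi 30 9 (r - 1 - 3 - 5) = 0"
    by (simp add: upto_rec1 flip: set_upto) (simp add: quasi_def)
  show "\<forall>M\<in>{0..23 - 1}. block_tails_nonneg 30 9 M"
    using assms(1) by (simp add: list_all_iff)
next
  fix M :: int
  assume "M \<ge> 23"
  moreover from this have "0 \<le> (M - 23) * (M - 1)" by simp
  ultimately show "9 \<le> M \<and> 2 * (2 * 30 - 22) \<le> 4 * M + 41 \<and>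
      2 * M * M + 2 * M + 41 - (2 * 30 - 22) \<le> 4 * (M * M - 1) + 2 * (9 + 1) - 22 * (2 * M - 1)"
    by (simp add: algebra_simps)
qed (use assms(2) in simp_all)

text \<open>The schematic variables prevent these long evaluations from being forked.\<close>

schematic_goal block_tails_nonneg_12_6: "list_all (block_tails_nonneg ?N ?s) [0..6]"
proof -
  show "list_all (block_tails_nonneg 12 6) [0..6]" by code_simp
qed

schematic_goal block_tails_nonneg_20_8: "list_all (block_tails_nonneg ?N ?s) [0..13]"
proof -
  show "list_all (block_tails_nonneg 20 8) [0..13]" by code_simp
qed

schematic_goal block_tails_nonneg_30_9: "list_all (block_tails_nonneg ?N ?s) [0..22]"
proof -
  show "list_all (block_tails_nonneg 30 9) [0..22]" by code_simp
qed

theorem corollary2p4: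
  fixes k :: int and n a b c :: nat
  assumes "k \<ge> 1"
    and "(a, b, c) \<in> {(1, 2, 3), (1, 2, 5), (1, 3, 5)}"
  shows "\<gamma> a b c 1 0 k n \<ge> 0"
  using assms(2) \<gamma>_1_2_3_nonneg[OF block_tails_nonneg_12_6 assms(1)]
    \<gamma>_1_2_5_nonneg[OF block_tails_nonneg_20_8 assms(1)]
    \<gamma>_1_3_5_nonneg[OF block_tails_nonneg_30_9 assms(1)] by auto

end
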